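(* Let $k$ be a field, let $n\ge 3$, and let $\mathcal A=\{d_1,\ldots,d_n\}\subset\mathbb Z^+$ be a generalized arithmetic sequence such that $\gcd(\mathcal A)=1$ and such that the numerical semigroup $\mathcal S=\sum_{i=1}^n\mathbb N d_i$ is minimally generated by $\mathcal A$. Then the toric ideal $I_{\mathcal A}$ is a complete intersection if and only if $n=3$ and $d_1$ is even.
   Context: $\mathbb N$ denotes the nonnegative integers and $\mathbb Z^+$ the positive integers. For $\mathcal A=\{d_1,\ldots,d_n\}\subset\mathbb Z^+$, the toric ideal $I_{\mathcal A}$ is the kernel of the $k$-algebra homomorphism $k[x_1,\ldots,x_n]\to k[t]$, $x_i\mapsto t^{d_i}$. It has height $n-1$; it is called a complete intersection if its minimal number of generators equals its height $n-1$ (equivalently, it is generated by $n-1$ binomials, each homogeneous for the grading $\deg x_i=d_i$). $\{d_1,\ldots,d_n\}$ is a generalized arithmetic sequence if there exists $h\in\mathbb Z^+$ such that $hd_1,d_2,\ldots,d_n$ is an increasing arithmetic sequence. $\mathcal S$ is minimally generated by $\mathcal A$ if no proper subset of $\mathcal A$ generates $\mathcal S$, i.e. $d_i\notin\sum_{j\ne i}\mathbb N d_j$ for every $i$. *)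

theory Defs
  imports "HOL-Library.Poly_Mapping" "HOL-Computational_Algebra.Polynomial" "HOL-Algebra.Ideal"
begin

text \<open>
  Multivariate polynomials in countably many variables are finitely supported maps from
  exponent vectors to coefficients, with the convolution product of
  \<^theory>\<open>HOL-Library.Poly_Mapping\<close>; the variable with index \<open>i\<close> is
  \<^term>\<open>Poly_Mapping.single (Poly_Mapping.single i 1) 1\<close>.
\<close>

type_synonym 'k mpoly = "(nat \<Rightarrow>\<^sub>0 nat) \<Rightarrow>\<^sub>0 'k"

definition mpolys :: "nat \<Rightarrow> 'k::field mpoly set" where
  "mpolys n = {p. \<forall>m\<in>Poly_Mapping.keys p. Poly_Mapping.keys m \<subseteq> {1..n}}"

text \<open>The polynomial ring \<open>k[x\<^sub>1, \<dots>, x\<^sub>n]\<close>.\<close>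

definition mpoly_ring :: "nat \<Rightarrow> 'k::field mpoly ring" where
  "mpoly_ring n = \<lparr>carrier = mpolys n, mult = (*), one = 1, zero = 0, add = (+)\<rparr>"

text \<open>The \<open>k\<close>-algebra homomorphism to \<open>k[t]\<close> with \<open>x\<^sub>i \<mapsto> t ^ d i\<close>.\<close>

definition toric_hom :: "(nat \<Rightarrow> nat) \<Rightarrow> 'k::field mpoly \<Rightarrow> 'k poly" where
  "toric_hom d p =
     (\<Sum>m\<in>Poly_Mapping.keys p.
        smult (Poly_Mapping.lookup p m)
          (\<Prod>i\<in>Poly_Mapping.keys m. (monom 1 (d i)) ^ Poly_Mapping.lookup m i))"

definition toric_ideal :: "nat \<Rightarrow> (nat \<Rightarrow> nat) \<Rightarrow> 'k::field mpoly set" where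
  "toric_ideal n d = {p \<in> carrier (mpoly_ring n). toric_hom d p = 0}"

text \<open>
  \<open>r\<close> is the least cardinality of a finite generating set of the ideal \<open>I\<close>; a relation
  rather than a function because ideals of an arbitrary ring need not have one.
\<close>

definition minimal_number_of_generators :: "('a, 'b) ring_scheme \<Rightarrow> 'a set \<Rightarrow> nat \<Rightarrow> bool" where
  "minimal_number_of_generators R I r \<longleftrightarrow>
     (\<exists>G \<subseteq> carrier R. finite G \<and> card G = r \<and> genideal R G = I) \<and>
     (\<forall>G \<subseteq> carrier R. finite G \<and> genideal R G = I \<longrightarrow> r \<le> card G)"

text \<open>
  The number \<open>n - 1\<close> is the height of the toric ideal of \<open>n\<close> positive integers, so this
  says that the minimal number of generators equals the height. Ideals are taken in
  \<open>k[x\<^sub>1, \<dots>, x\<^sub>n]\<close>, and generators are arbitrary polynomials, not only binomials.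
\<close>

definition toric_complete_intersection ::
    "'k::field itself \<Rightarrow> nat \<Rightarrow> (nat \<Rightarrow> nat) \<Rightarrow> bool" where
  "toric_complete_intersection _ n d \<longleftrightarrow>
     minimal_number_of_generators (mpoly_ring n) (toric_ideal n d :: 'k mpoly set) (n - 1)"

definition increasing_arithmetic_sequence :: "nat \<Rightarrow> (nat \<Rightarrow> nat) \<Rightarrow> bool" where
  "increasing_arithmetic_sequence n a \<longleftrightarrow>
     (\<exists>\<delta>>0. \<forall>i\<in>{1..<n}. a (i + 1) = a i + \<delta>)"

definition generalized_arithmetic_sequence :: "nat \<Rightarrow> (nat \<Rightarrow> nat) \<Rightarrow> bool" where
  "generalized_arithmetic_sequence n d \<longleftrightarrow>
     (\<exists>h>0. increasing_arithmetic_sequence n (d(1 := h * d 1)))"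

definition generated_semigroup :: "nat set \<Rightarrow> nat set" where
  "generated_semigroup A = {(\<Sum>a\<in>A. c a * a) |c. True}"

definition minimally_generates :: "nat set \<Rightarrow> nat set \<Rightarrow> bool" where
  "minimally_generates A S \<longleftrightarrow>
     generated_semigroup A = S \<and> (\<forall>B. B \<subset> A \<longrightarrow> generated_semigroup B \<noteq> S)"

lemma mpoly_ring_cring: "cring (mpoly_ring n :: 'k::field mpoly ring)"
proof -
  have add: "p + q \<in> mpolys n" if "p \<in> mpolys n" "q \<in> mpolys n" for p q :: "'k mpoly"
    using that Poly_Mapping.keys_add[of p q] by (fastforce simp: mpolys_def)
  have uminus: "- p \<in> mpolys n" if "p \<in> mpolys n" for p :: "'k mpoly"
    using that by (simp add: mpolys_def)
  have mult: "p * q \<in> mpolys n" if "p \<in> mpolys n" "q \<in> mpolys n" for p q :: "'k mpoly"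
    unfolding mpolys_def
  proof clarify
    fix m i assume "m \<in> Poly_Mapping.keys (p * q)" "i \<in> Poly_Mapping.keys m"
    then obtain a b where ab: "a \<in> Poly_Mapping.keys p" "b \<in> Poly_Mapping.keys q"
      "i \<in> Poly_Mapping.keys (a + b)"
      using Poly_Mapping.keys_mult[of p q] by blast
    then have "i \<in> Poly_Mapping.keys a \<union> Poly_Mapping.keys b"
      using Poly_Mapping.keys_add[of a b] by blast
    then show "i \<in> {1..n}" using ab that unfolding mpolys_def by blast
  qed
  have zero: "0 \<in> mpolys n" and one: "1 \<in> mpolys n"
    by (auto simp: mpolys_def)
  show ?thesis
  proof (rule cringI)
    show "abelian_group (mpoly_ring n :: 'k mpoly ring)"
      by (rule abelian_groupI)
        (auto simp: mpoly_ring_def add zero add_ac intro!: bexI[of _ "- x" for x] uminus)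
    show "Group.comm_monoid (mpoly_ring n :: 'k mpoly ring)"
      by (rule comm_monoidI) (auto simp: mpoly_ring_def mult one mult_ac)
  qed (auto simp: mpoly_ring_def distrib_right)
qed

lemma toric_hom_single:
  "toric_hom d (Poly_Mapping.single m c) =
     monom c (\<Sum>i\<in>Poly_Mapping.keys m. d i * Poly_Mapping.lookup m i)"
proof -
  have "(\<Prod>i\<in>X. (monom (1::'a) (d i)) ^ e i) = monom 1 (\<Sum>i\<in>X. d i * e i)"
    if "finite X" for X e
    using that by induction (simp_all add: monom_power mult_monom)
  then show ?thesis
    by (simp add: toric_hom_def smult_monom)
qed

lemma toric_hom_var: "toric_hom d (Poly_Mapping.single (Poly_Mapping.single i 1) 1) = monom 1 (d i)"
  by (simp add: toric_hom_single)

lemma toric_hom_const: "toric_hom d (Poly_Mapping.single 0 c) = [:c:]"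
  by (simp add: toric_hom_single monom_0)

lemma toric_hom_add: "toric_hom d (p + q) = toric_hom d p + toric_hom d q"
  unfolding toric_hom_def
  by (rule setsum_keys_plus_distrib) (simp_all add: smult_add_left)

lemma toric_hom_mult: "toric_hom d (p * q) = toric_hom d p * toric_hom d q"
proof -
  let ?S = "Poly_Mapping.single" and ?K = "Poly_Mapping.keys" and ?L = "Poly_Mapping.lookup"
  have wt: "(\<Sum>i\<in>?K (a + b). d i * ?L (a + b) i) =
      (\<Sum>i\<in>?K a. d i * ?L a i) + (\<Sum>i\<in>?K b. d i * ?L b i)" for a b :: "nat \<Rightarrow>\<^sub>0 nat"
    by (rule setsum_keys_plus_distrib) (simp_all add: algebra_simps)
  have rep: "\<exists>A c. finite A \<and> p = (\<Sum>m\<in>A. ?S m (c m))" for p :: "'a mpoly"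
    by (intro exI[of _ "?K p"] exI[of _ "?L p"] conjI poly_mapping_eqI)
      (auto simp: lookup_sum lookup_single when_def in_keys_iff)
  have hsum: "toric_hom d (\<Sum>x\<in>A. f x) = (\<Sum>x\<in>A. toric_hom d (f x))"
    if "finite A" for A and f :: "'b \<Rightarrow> 'a mpoly"
    using that by induction (simp_all add: toric_hom_add, simp add: toric_hom_def)
  obtain A c where A: "finite A" "p = (\<Sum>m\<in>A. ?S m (c m))" using rep by blast
  obtain B e where B: "finite B" "q = (\<Sum>m\<in>B. ?S m (e m))" using rep by blast
  show ?thesis
    unfolding A(2) B(2)
    by (simp add: sum_product hsum A(1) B(1) mult_single toric_hom_single wt mult_monom)
qed

end

theory Submission
  imports Defs "HOL-Library.Function_Algebras" "HOL-Number_Theory.Cong"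
begin

text \<open>
  Call a monomial isolated if no other monomial of its weight shares a variable with it. The
  coefficient \<open>\<phi>\<^sub>u\<close> at an isolated monomial \<open>u\<close> satisfies \<open>\<phi>\<^sub>u (p q) = p(0) \<phi>\<^sub>u q\<close> for \<open>q\<close> in the toric
  ideal. Hence a family of binomials \<open>u\<^sub>j - v\<^sub>j\<close> in the ideal with isolated \<open>u\<^sub>j\<close> and a triangular matrix of
  coefficients bounds the size of every generating set, homogeneous or not, from below.

  Write \<open>d\<^sub>1 = a\<close> and \<open>d\<^sub>i = h a + (i - 1) \<delta>\<close>. By minimality every product of two variables is isolated,
  and so is the least power of a variable that has the weight of a monomial in the other variables.
  For \<open>n \<ge> 4\<close> the monomials \<open>x\<^sub>2 x\<^sub>2, \<dots>, x\<^sub>2 x\<^bsub>n-1\<^esub>, x\<^sub>3 x\<^bsub>n-1\<^esub>\<close> and the least such power of \<open>x\<^sub>1\<close> give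
  \<open>n\<close> independent relations. For \<open>n = 3\<close> and \<open>a\<close> odd, \<open>x\<^sub>2\<^sup>2\<close> and the least powers of \<open>x\<^sub>1\<close> and \<open>x\<^sub>3\<close> give
  three. For \<open>n = 3\<close> and \<open>a = 2 m\<close>, modulo \<open>x\<^sub>2\<^sup>2 - x\<^sub>1\<^sup>h x\<^sub>3\<close> and \<open>x\<^sub>3\<^sup>m - x\<^sub>1\<^bsup>m h + \<delta>\<^esup>\<close> every monomial reduces to
  \<open>x\<^sub>1\<^sup>i x\<^sub>2\<^sup>j x\<^sub>3\<^sup>k\<close> with \<open>j < 2\<close> and \<open>k < m\<close>, and its weight modulo \<open>a\<close> determines \<open>j + 2 k\<close>.
\<close>

section \<open>Weights of monomials\<close>

text \<open>The exponent of \<open>t\<close> in the image of a monomial under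
  \<open>toric_hom\<close>; summing over \<open>keys u\<close> makes it agree literally with
  \<open>toric_hom_single\<close>.\<close>

definition weight :: "(nat \<Rightarrow> nat) \<Rightarrow> (nat \<Rightarrow>\<^sub>0 nat) \<Rightarrow> nat" where
  "weight d u = (\<Sum>i\<in>Poly_Mapping.keys u. d i * Poly_Mapping.lookup u i)"

lemma weight_0 [simp]: "weight d 0 = 0"
  by (simp add: weight_def)

lemma weight_add [simp]: "weight d (u + v) = weight d u + weight d v"
  unfolding weight_def by (rule setsum_keys_plus_distrib) (simp_all add: algebra_simps)

lemma weight_single [simp]: "weight d (Poly_Mapping.single i c) = d i * c"
  by (simp add: weight_def)

lemma weight_pos:
  assumes "Poly_Mapping.keys u \<subseteq> A" "\<forall>i\<in>A. d i > 0" "u \<noteq> 0"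
  shows "weight d u > 0"
proof -
  obtain i where i: "i \<in> Poly_Mapping.keys u" using assms(3) by fastforce
  then have "d i * Poly_Mapping.lookup u i > 0" using assms(1,2) i by (auto simp: in_keys_iff subset_iff)
  then show ?thesis
    unfolding weight_def using i by (intro sum_pos2[of _ i]) simp_all
qed

lemma keys_plus_nat [simp]:
  "Poly_Mapping.keys (u + v :: 'a \<Rightarrow>\<^sub>0 nat) = Poly_Mapping.keys u \<union> Poly_Mapping.keys v"
  by (auto simp: in_keys_iff lookup_add)

lemma lookup_neqI: "Poly_Mapping.lookup x i \<noteq> Poly_Mapping.lookup y i \<Longrightarrow> x \<noteq> y"
  by blast

lemma split_variable:
  fixes u :: "'a \<Rightarrow>\<^sub>0 nat"
  obtains w where "u = Poly_Mapping.single i (Poly_Mapping.lookup u i) + w"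
    "i \<notin> Poly_Mapping.keys w" "Poly_Mapping.keys w \<subseteq> Poly_Mapping.keys u"
proof (rule that)
  let ?w = "u - Poly_Mapping.single i (Poly_Mapping.lookup u i)"
  show "u = Poly_Mapping.single i (Poly_Mapping.lookup u i) + ?w"
    by (rule poly_mapping_eqI) (auto simp: lookup_add lookup_minus lookup_single when_def)
  show "i \<notin> Poly_Mapping.keys ?w" "Poly_Mapping.keys ?w \<subseteq> Poly_Mapping.keys u"
    by (auto simp: in_keys_iff lookup_minus)
qed

lemma poly_mapping_sum_single:
  "p = (\<Sum>m\<in>Poly_Mapping.keys p. Poly_Mapping.single m (Poly_Mapping.lookup p m))"
  by (rule poly_mapping_eqI) (auto simp: lookup_sum lookup_single when_def in_keys_iff)

section \<open>Toric ideals\<close>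

lemma mpolys_0 [simp]: "0 \<in> mpolys n" and mpolys_1 [simp]: "1 \<in> mpolys n"
  by (auto simp: mpolys_def)

lemma mpolys_single [simp]:
  "Poly_Mapping.keys m \<subseteq> {1..n} \<Longrightarrow> Poly_Mapping.single m c \<in> mpolys n"
  by (auto simp: mpolys_def)

lemma mpolys_add [simp]: "p \<in> mpolys n \<Longrightarrow> q \<in> mpolys n \<Longrightarrow> p + q \<in> mpolys n"
  using Poly_Mapping.keys_add[of p q] unfolding mpolys_def by blast

lemma mpolys_uminus [simp]: "p \<in> mpolys n \<Longrightarrow> - p \<in> mpolys n"
  by (simp add: mpolys_def)

lemma mpolys_diff [simp]: "p \<in> mpolys n \<Longrightarrow> q \<in> mpolys n \<Longrightarrow> p - q \<in> mpolys n"
  using mpolys_add[of p n "- q"] by simp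

lemma mpolys_mult [simp]: "p \<in> mpolys n \<Longrightarrow> q \<in> mpolys n \<Longrightarrow> p * q \<in> mpolys n"
  using cring.cring_simprules(5)[OF mpoly_ring_cring, of p n q] by (simp add: mpoly_ring_def)

text \<open>Additive inverses come from multiplication by the constant \<open>- 1\<close>, so
  closure under sums and ring multiples already gives a subgroup.\<close>

lemma ideal_mpoly_ring_iff:
  fixes J :: "'k::field mpoly set"
  shows "ideal J (mpoly_ring n) \<longleftrightarrow> J \<subseteq> mpolys n \<and> 0 \<in> J \<and> (\<forall>p\<in>J. \<forall>q\<in>J. p + q \<in> J) \<and>
    (\<forall>r\<in>mpolys n. \<forall>p\<in>J. r * p \<in> J)"
proof
  assume "ideal J (mpoly_ring n)"
  then interpret ideal J "mpoly_ring n" .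
  show "J \<subseteq> mpolys n \<and> 0 \<in> J \<and> (\<forall>p\<in>J. \<forall>q\<in>J. p + q \<in> J) \<and>
    (\<forall>r\<in>mpolys n. \<forall>p\<in>J. r * p \<in> J)"
    using Icarr additive_subgroup.zero_closed[OF is_additive_subgroup]
      additive_subgroup.a_closed[OF is_additive_subgroup] I_l_closed
    by (auto simp: mpoly_ring_def)
next
  interpret R: cring "mpoly_ring n :: 'k mpoly ring" by (rule mpoly_ring_cring)
  assume *: "J \<subseteq> mpolys n \<and> 0 \<in> J \<and> (\<forall>p\<in>J. \<forall>q\<in>J. p + q \<in> J) \<and>
    (\<forall>r\<in>mpolys n. \<forall>p\<in>J. r * p \<in> J)"
  have minus: "inv\<^bsub>add_monoid (mpoly_ring n)\<^esub> p \<in> J" if "p \<in> J" for p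
  proof -
    have "inv\<^bsub>add_monoid (mpoly_ring n)\<^esub> p = - p"
      using that * R.minus_equality[of "- p" p] mpolys_uminus[of p n]
      by (auto simp: a_inv_def mpoly_ring_def)
    moreover have "- 1 * p \<in> J" using * that mpolys_uminus[OF mpolys_1[where 'b = 'k]] by metis
    ultimately show ?thesis by simp
  qed
  show "ideal J (mpoly_ring n)"
  proof (rule idealI)
    show "subgroup J (add_monoid (mpoly_ring n))"
      by (rule group.subgroupI[OF R.a_group]) (use * minus in \<open>auto simp: mpoly_ring_def\<close>)
    show "ring (mpoly_ring n :: 'k mpoly ring)" by (rule R.ring_axioms)
    fix a x :: "'k mpoly" assume "a \<in> J" "x \<in> carrier (mpoly_ring n)"
    then have "x * a \<in> J" using * by (simp add: mpoly_ring_def)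
    then show "x \<otimes>\<^bsub>mpoly_ring n\<^esub> a \<in> J" "a \<otimes>\<^bsub>mpoly_ring n\<^esub> x \<in> J"
      by (simp_all add: mpoly_ring_def mult.commute)
  qed
qed

lemma toric_hom_0 [simp]: "toric_hom d 0 = 0"
  by (simp add: toric_hom_def)

lemma toric_ideal_iff: "p \<in> toric_ideal n d \<longleftrightarrow> p \<in> mpolys n \<and> toric_hom d p = 0"
  by (simp add: toric_ideal_def mpoly_ring_def)

lemma ideal_toric_ideal: "ideal (toric_ideal n d :: 'k::field mpoly set) (mpoly_ring n)"
  by (auto simp: ideal_mpoly_ring_iff toric_ideal_iff toric_hom_add toric_hom_mult)

text \<open>Monomials of equal weight have images in the same degree, so membership in the toric
  ideal says that the coefficients within each weight sum to zero.\<close>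

lemma coeff_toric_hom:
  "coeff (toric_hom d p) w =
     (\<Sum>m | m \<in> Poly_Mapping.keys p \<and> weight d m = w. Poly_Mapping.lookup p m)"
proof -
  have "toric_hom d (sum f A) = (\<Sum>x\<in>A. toric_hom d (f x))"
    if "finite A" for A and f :: "(nat \<Rightarrow>\<^sub>0 nat) \<Rightarrow> 'a mpoly"
    using that by induction (simp_all add: toric_hom_add)
  then have "toric_hom d p =
      (\<Sum>m\<in>Poly_Mapping.keys p. monom (Poly_Mapping.lookup p m) (weight d m))"
    by (subst poly_mapping_sum_single[of p]) (simp add: toric_hom_single weight_def)
  then show ?thesis
    by (simp add: coeff_sum sum.If_cases Int_def conj_commute)
qed

definition pure_binomial :: "(nat \<Rightarrow>\<^sub>0 nat) \<Rightarrow> (nat \<Rightarrow>\<^sub>0 nat) \<Rightarrow> 'k::field mpoly" where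
  "pure_binomial u v = Poly_Mapping.single u 1 - Poly_Mapping.single v 1"

lemma binomial_in_toric_ideal:
  assumes "Poly_Mapping.keys u \<subseteq> {1..n}" "Poly_Mapping.keys v \<subseteq> {1..n}" "weight d u = weight d v"
  shows "pure_binomial u v \<in> (toric_ideal n d :: 'k::field mpoly set)"
proof -
  have "toric_hom d (Poly_Mapping.single u 1 + Poly_Mapping.single v (- 1) :: 'k mpoly) = 0"
    using assms(3) by (simp add: toric_hom_add toric_hom_single weight_def add_monom)
  then show ?thesis
    using assms(1,2) by (simp add: toric_ideal_iff pure_binomial_def single_uminus)
qed

section \<open>Isolated monomials\<close>

definition isolated :: "nat \<Rightarrow> (nat \<Rightarrow> nat) \<Rightarrow> (nat \<Rightarrow>\<^sub>0 nat) \<Rightarrow> bool" where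
  "isolated n d u \<longleftrightarrow> (\<forall>v. Poly_Mapping.keys v \<subseteq> {1..n} \<and> weight d v = weight d u \<and>
     Poly_Mapping.keys u \<inter> Poly_Mapping.keys v \<noteq> {} \<longrightarrow> v = u)"

text \<open>
  A proper divisor \<open>b\<close> of an isolated monomial is alone in its weight, since \<open>u = a + b\<close> shares
  the variables of \<open>a\<close> with \<open>a + m\<close>; so its coefficient in an element of the toric ideal is zero.
\<close>

lemma lookup_mult_isolated:
  fixes q :: "'k::field mpoly"
  assumes "isolated n d u" "Poly_Mapping.keys u \<subseteq> {1..n}" "q \<in> toric_ideal n d"
  shows "Poly_Mapping.lookup (p * q) u = Poly_Mapping.lookup p 0 * Poly_Mapping.lookup q u"
proof -
  have q: "q \<in> mpolys n" "toric_hom d q = 0" using assms(3) by (auto simp: toric_ideal_iff)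
  have zero: "Poly_Mapping.lookup q b = 0" if ab: "u = a + b" "a \<noteq> 0" for a b
  proof -
    have "m = b" if "m \<in> Poly_Mapping.keys q" "weight d m = weight d b" for m
    proof -
      have "Poly_Mapping.keys (a + m) \<subseteq> {1..n}" "weight d (a + m) = weight d u"
        "Poly_Mapping.keys u \<inter> Poly_Mapping.keys (a + m) \<noteq> {}"
        using that q(1) assms(2) ab by (auto simp: mpolys_def keys_eq_empty[symmetric] simp del: keys_eq_empty)
      then have "a + m = u"
        using assms(1) unfolding isolated_def by blast
      then show ?thesis using ab by simp
    qed
    then have "(\<Sum>m | m \<in> Poly_Mapping.keys q \<and> weight d m = weight d b. Poly_Mapping.lookup q m)
        = (\<Sum>m\<in>{b}. Poly_Mapping.lookup q m)"
      by (intro sum.mono_neutral_left) (auto simp: in_keys_iff)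
    then show ?thesis using coeff_toric_hom[of d q "weight d b"] q(2) by simp
  qed
  \<comment> \<open>Only \<open>l = 0\<close> contributes to the convolution: for other
    \<open>l\<close> the cofactor \<open>b\<close> in \<open>u = l + b\<close> is a proper divisor
    of \<open>u\<close>.\<close>
  have "Poly_Mapping.lookup (p * q) u =
      Sum_any (\<lambda>l :: nat \<Rightarrow>\<^sub>0 nat. (Poly_Mapping.lookup p 0 * Poly_Mapping.lookup q u) when l = 0)"
    unfolding lookup_mult
  proof (rule arg_cong[where f = Sum_any], rule ext)
    fix l
    show "Poly_Mapping.lookup p l * Sum_any (\<lambda>b. Poly_Mapping.lookup q b when u = l + b) =
        (Poly_Mapping.lookup p 0 * Poly_Mapping.lookup q u when l = 0)"
    proof (cases "l = 0")
      case False
      then have "(Poly_Mapping.lookup q b when u = l + b) = 0" for b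
        using zero by (auto simp: when_def)
      then have "Sum_any (\<lambda>b. Poly_Mapping.lookup q b when u = l + b) = 0"
        by (simp only: Sum_any.neutral)
      then show ?thesis using False by simp
    qed simp
  qed
  then show ?thesis by simp
qed

text \<open>Taking coefficients at the \<open>u j\<close> turns ring multiples into scalar
  multiples, so the images of \<open>G\<close> span the image of the whole ideal. The triangular
  binomials give \<open>N\<close> independent vectors there.\<close>

lemma card_generators_ge:
  fixes G :: "'k::field mpoly set"
  assumes G: "G \<subseteq> carrier (mpoly_ring n)" "finite G" "genideal (mpoly_ring n) G = toric_ideal n d"
    and iso: "\<And>j. j < N \<Longrightarrow> isolated n d (u j)"
    and keys: "\<And>j. j < N \<Longrightarrow> Poly_Mapping.keys (u j) \<subseteq> {1..n} \<and> Poly_Mapping.keys (v j) \<subseteq> {1..n}"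
    and wt: "\<And>j. j < N \<Longrightarrow> weight d (u j) = weight d (v j)"
    and neq: "\<And>j. j < N \<Longrightarrow> u j \<noteq> v j"
    and tri: "\<And>i j. i < j \<Longrightarrow> j < N \<Longrightarrow> u j \<noteq> u i \<and> u j \<noteq> v i"
  shows "N \<le> card G"
proof -
  interpret R: cring "mpoly_ring n :: 'k mpoly ring" by (rule mpoly_ring_cring)
  interpret V: vector_space "\<lambda>c x (j :: nat). c * (x j :: 'k)"
    by unfold_locales (auto simp: fun_eq_iff algebra_simps)
  \<comment> \<open>The cut-off at \<open>N\<close> confines the coordinates to isolated
    \<open>u j\<close>, where the product rule \<open>mult\<close> is valid.\<close>
  define \<Phi> where "\<Phi> = (\<lambda>(p :: 'k mpoly) j. if j < N then Poly_Mapping.lookup p (u j) else 0)"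
  \<comment> \<open>Once \<open>J\<close> is known to be an ideal, containing \<open>G\<close> makes
    it contain the whole toric ideal.\<close>
  define J where "J = {p \<in> toric_ideal n d. \<Phi> p \<in> V.span (\<Phi> ` G)}"
  have add: "\<Phi> (p + q) = \<Phi> p + \<Phi> q" for p q
    by (auto simp: \<Phi>_def fun_eq_iff lookup_add)
  have mult: "\<Phi> (p * q) = (\<lambda>j. Poly_Mapping.lookup p 0 * \<Phi> q j)" if "q \<in> toric_ideal n d" for p q
    using lookup_mult_isolated[OF iso _ that] keys by (auto simp: \<Phi>_def fun_eq_iff)
  have zero: "\<Phi> 0 = 0" by (auto simp: \<Phi>_def)
  have "ideal J (mpoly_ring n)"
    using ideal_toric_ideal[of n d, where 'k = 'k]
    by (auto simp: ideal_mpoly_ring_iff J_def add mult zero V.span_zero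
        intro: V.span_add V.span_scale)
  moreover have "G \<subseteq> J"
    using R.genideal_self[OF G(1)] G(3) by (auto simp: J_def intro: V.span_base)
  ultimately have J: "toric_ideal n d \<subseteq> J"
    using R.genideal_minimal G(3) by metis
  define w where "w i = \<Phi> (pure_binomial (u i) (v i))" for i
  have w_span: "w i \<in> V.span (\<Phi> ` G)" if "i < N" for i
  proof -
    have "pure_binomial (u i) (v i) \<in> (toric_ideal n d :: 'k mpoly set)"
      using keys[OF that] wt[OF that] by (intro binomial_in_toric_ideal) auto
    then show ?thesis using J unfolding J_def w_def by blast
  qed
  have w_diag: "w j j \<noteq> 0" if "j < N" for j
    using that neq[of j] by (simp add: w_def \<Phi>_def pure_binomial_def lookup_minus lookup_single)
  have w_zero: "w i j = 0" if "i < j" "j < N" for i j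
    using that tri[of i j]
    by (auto simp add: w_def \<Phi>_def pure_binomial_def lookup_minus lookup_single when_def)
  have "\<not> V.dependent (w ` {..<m}) \<and> card (w ` {..<m}) = m" if "m \<le> N" for m
    using that
  proof (induction m)
    case (Suc m)
    \<comment> \<open>All earlier \<open>w i\<close> vanish at coordinate \<open>m\<close>, whereas
      \<open>w m\<close> does not, so \<open>w m\<close> lies outside their span.\<close>
    have "V.subspace {x. x m = 0}"
      by (auto simp: V.subspace_def)
    then have "V.span (w ` {..<m}) \<subseteq> {x. x m = 0}"
      using w_zero Suc.prems by (intro V.span_minimal) auto
    then have m: "w m \<notin> V.span (w ` {..<m})"
      using w_diag[of m] Suc.prems by auto
    then have "w m \<notin> w ` {..<m}" by (metis V.span_base)
    moreover have "\<not> V.dependent (w ` {..<m})" "card (w ` {..<m}) = m"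
      using Suc by simp_all
    ultimately show ?case
      using V.independent_insertI[OF m] by (simp add: lessThan_Suc)
  qed (simp add: V.independent_empty)
  then have indep: "\<not> V.dependent (w ` {..<N})" "card (w ` {..<N}) = N" by simp_all
  have "w ` {..<N} \<subseteq> V.span (\<Phi> ` G)" using w_span by blast
  then have "N \<le> card (\<Phi> ` G)"
    using V.independent_span_bound[OF finite_imageI[OF G(2)] indep(1)] indep(2) by simp
  also have "\<dots> \<le> card G" using G(2) by (rule card_image_le)
  finally show ?thesis .
qed

text \<open>Suppose a monomial with the weight of the least power \<open>x_i^c\<close> contains
  \<open>x_i^k\<close> with \<open>k > 0\<close>. Cancelling \<open>x_i^k\<close> leaves a relation
  for the power \<open>c - k\<close>, which leastness allows only if \<open>c = k\<close> and
  nothing remains.\<close>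

lemma isolated_least_power:
  assumes pos: "\<forall>i\<in>{1..n}. d i > 0" and ij: "i \<in> {1..n}" "j \<in> {1..n}" "i \<noteq> j"
  obtains c v where "c > 0" "isolated n d (Poly_Mapping.single i c)"
    "Poly_Mapping.keys v \<subseteq> {1..n} - {i}" "weight d v = d i * c"
    "\<And>c' v'. c' > 0 \<Longrightarrow> Poly_Mapping.keys v' \<subseteq> {1..n} - {i} \<Longrightarrow> weight d v' = d i * c' \<Longrightarrow> c \<le> c'"
proof -
  define P where
    "P c \<longleftrightarrow> c > 0 \<and> (\<exists>v. Poly_Mapping.keys v \<subseteq> {1..n} - {i} \<and> weight d v = d i * c)" for c
  \<comment> \<open>\<open>x_i\<close> to the power \<open>d j\<close> and \<open>x_j\<close> to the
    power \<open>d i\<close> have the same weight, so some admissible power exists.\<close>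
  have "P (d j)"
    unfolding P_def using pos ij
    by (intro conjI exI[of _ "Poly_Mapping.single j (d i)"]) (auto split: if_splits)
  then obtain c where c: "P c" and least: "\<And>c'. P c' \<Longrightarrow> c \<le> c'"
    by (metis Least_le LeastI)
  have "isolated n d (Poly_Mapping.single i c)"
    unfolding isolated_def
  proof (intro allI impI, elim conjE)
    fix v
    assume v: "Poly_Mapping.keys v \<subseteq> {1..n}" "weight d v = weight d (Poly_Mapping.single i c)"
      and x: "Poly_Mapping.keys (Poly_Mapping.single i c) \<inter> Poly_Mapping.keys v \<noteq> {}"
    define k where "k = Poly_Mapping.lookup v i"
    have k: "k > 0" using x by (auto simp: k_def in_keys_iff split: if_splits)
    obtain w where w: "v = Poly_Mapping.single i k + w" "i \<notin> Poly_Mapping.keys w"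
      "Poly_Mapping.keys w \<subseteq> Poly_Mapping.keys v"
      using split_variable unfolding k_def by metis
    have wt: "d i * k + weight d w = d i * c" using v(2) by (simp add: w(1))
    then have "k \<le> c" using pos ij(1) by (metis le_add1 nat_mult_le_cancel1)
    then have "weight d w = d i * (c - k)" using wt by (simp add: diff_mult_distrib2)
    then have "c - k = 0"
      using least[of "c - k"] w v(1) k c unfolding P_def by fastforce
    then have "c = k" "weight d w = 0" using \<open>k \<le> c\<close> \<open>weight d w = _\<close> by auto
    then have "w = 0" using weight_pos[of w "{1..n}" d] w(3) v(1) pos by (metis less_irrefl order_trans)
    then show "v = Poly_Mapping.single i c" using w(1) \<open>c = k\<close> by simp
  qed
  then show ?thesis using c least that unfolding P_def by blast
qed

section \<open>Minimally generated semigroups\<close>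

lemma weight_eq_sum:
  assumes "Poly_Mapping.keys u \<subseteq> A" "finite A"
  shows "weight d u = (\<Sum>i\<in>A. d i * Poly_Mapping.lookup u i)"
  unfolding weight_def using assms by (intro sum.mono_neutral_left) (auto simp: in_keys_iff)

text \<open>If \<open>x_i\<close> were absent from \<open>v\<close>, then \<open>d i\<close> would
  be a combination of the other generators, and deleting it would leave the semigroup unchanged. So
  \<open>x_i\<close> divides \<open>v\<close>, and positivity of the weights leaves no room for
  more.\<close>

lemma minimally_generates_weight_eq_generator:
  assumes pos: "\<forall>i\<in>{1..n}. d i > 0" and inj: "inj_on d {1..n}"
    and min: "minimally_generates (d ` {1..n}) S"
    and i: "i \<in> {1..n}" and v: "Poly_Mapping.keys v \<subseteq> {1..n}" "weight d v = d i"
  shows "v = Poly_Mapping.single i 1"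
proof -
  let ?A = "d ` {1..n}"
  obtain w where w: "v = Poly_Mapping.single i (Poly_Mapping.lookup v i) + w"
    "i \<notin> Poly_Mapping.keys w" "Poly_Mapping.keys w \<subseteq> Poly_Mapping.keys v"
    by (rule split_variable)
  define k where "k = Poly_Mapping.lookup v i"
  have wt: "d i * k + weight d w = d i" using w(1) v(2) by (metis k_def weight_add weight_single)
  have di: "d i > 0" using pos i by blast
  have "k \<noteq> 0"
  proof
    assume "k = 0"
    \<comment> \<open>\<open>generated_semigroup\<close> indexes coefficients by generators, not by
      positions, so the exponents are transported along the inverse of \<open>d\<close>.\<close>
    define e where "e a = Poly_Mapping.lookup w (the_inv_into {1..n} d a)" for a
    have "d i = (\<Sum>j\<in>{1..n} - {i}. d j * Poly_Mapping.lookup w j)"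
      using wt \<open>k = 0\<close> weight_eq_sum[of w "{1..n} - {i}" d] w v(1) by auto
    also have "\<dots> = (\<Sum>j\<in>{1..n} - {i}. e (d j) * d j)"
      by (intro sum.cong) (auto simp: e_def the_inv_into_f_f[OF inj] simp del: One_nat_def)
    also have "\<dots> = (\<Sum>a\<in>d ` ({1..n} - {i}). e a * a)"
      by (subst sum.reindex) (auto intro: inj_on_subset[OF inj])
    also have "d ` ({1..n} - {i}) = ?A - {d i}"
      using inj_on_image_set_diff[OF inj, of "{1..n}" "{i}"] i by simp
    finally have e: "d i = (\<Sum>a\<in>?A - {d i}. e a * a)" .
    have "generated_semigroup (?A - {d i}) = generated_semigroup ?A"
    proof (intro equalityI subsetI)
      fix x assume "x \<in> generated_semigroup (?A - {d i})"
      then obtain c where "x = (\<Sum>a\<in>?A - {d i}. c a * a)"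
        by (auto simp: generated_semigroup_def)
      then have "x = (\<Sum>a\<in>?A. (c(d i := 0)) a * a)"
        using i by (subst sum.remove[of ?A "d i"]) (auto intro: sum.cong)
      then show "x \<in> generated_semigroup ?A" by (auto simp only: generated_semigroup_def)
    next
      fix x assume "x \<in> generated_semigroup ?A"
      then obtain c where "x = (\<Sum>a\<in>?A. c a * a)" by (auto simp: generated_semigroup_def)
      \<comment> \<open>The summand for \<open>d i\<close> is replaced by its expression through the
        other generators.\<close>
      then have "x = c (d i) * (\<Sum>a\<in>?A - {d i}. e a * a) + (\<Sum>a\<in>?A - {d i}. c a * a)"
        using i by (subst (asm) sum.remove[of ?A "d i"]) (auto simp: e[symmetric] simp del: One_nat_def)
      then have "x = (\<Sum>a\<in>?A - {d i}. (c (d i) * e a + c a) * a)"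
        by (simp add: sum_distrib_left sum.distrib algebra_simps)
      then show "x \<in> generated_semigroup (?A - {d i})" by (auto simp only: generated_semigroup_def)
    qed
    moreover have "?A - {d i} \<subset> ?A" using i by blast
    ultimately show False using min unfolding minimally_generates_def by metis
  qed
  moreover have "k \<le> 1" using wt di by (metis le_add1 mult.right_neutral nat_mult_le_cancel1)
  ultimately have "k = 1" by simp
  then have "w = 0" using wt weight_pos[of w "{1..n}" d] w(3) v(1) pos by fastforce
  then show ?thesis using w(1) \<open>k = 1\<close> k_def by simp
qed

text \<open>Minimality of the generators enters through \<open>unique\<close>, gcd one through
  \<open>coprime\<close>. The formula for \<open>d i\<close> starts at index 2 because the
  progression begins with \<open>h * d 1\<close> rather than \<open>d 1\<close>.\<close>

locale gas_semigroup =
  fixes n :: nat and d :: "nat \<Rightarrow> nat" and h \<delta> :: nat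
  assumes n: "n \<ge> 3" and h: "h > 0" and \<delta>: "\<delta> > 0"
    and d1: "d 1 > 0" and d: "\<And>i. i \<in> {2..n} \<Longrightarrow> d i = h * d 1 + (i - 1) * \<delta>"
    and coprime: "coprime (d 1) \<delta>"
    and unique: "\<And>i v. i \<in> {1..n} \<Longrightarrow> Poly_Mapping.keys v \<subseteq> {1..n} \<Longrightarrow> weight d v = d i \<Longrightarrow>
      v = Poly_Mapping.single i 1"

lemma increasing_arithmetic_sequence_nth:
  assumes "\<forall>i\<in>{1..<n}. a (i + 1) = a i + \<delta>" "i \<in> {1..n}"
  shows "a i = a 1 + (i - 1) * (\<delta> :: nat)"
  using assms(2)
proof (induction i)
  case (Suc i)
  show ?case
  proof (cases "i = 0")
    case False
    then have "a (i + 1) = a i + \<delta>" "a i = a 1 + (i - 1) * \<delta>" using Suc assms(1) by auto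
    then show ?thesis using False by (cases i) auto
  qed simp
qed simp

lemma gas_semigroupI:
  assumes "n \<ge> 3" and pos: "\<forall>i\<in>{1..n}. d i > 0"
    and gas: "generalized_arithmetic_sequence n d" and gcd: "Gcd (d ` {1..n}) = 1"
    and min: "minimally_generates (d ` {1..n}) S"
  obtains h \<delta> where "gas_semigroup n d h \<delta>"
proof -
  obtain h \<delta> where h: "h > 0" and \<delta>: "\<delta> > 0"
    and step: "\<forall>i\<in>{1..<n}. (d(1 := h * d 1)) (i + 1) = (d(1 := h * d 1)) i + \<delta>"
    using gas unfolding generalized_arithmetic_sequence_def increasing_arithmetic_sequence_def by blast
  have d: "d i = h * d 1 + (i - 1) * \<delta>" if "i \<in> {2..n}" for i
    using increasing_arithmetic_sequence_nth[OF step, of i] that by (auto split: if_splits)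
  have d1: "d 1 > 0" using pos assms(1) by auto
  have "strict_mono_on {1..n} d"
  proof (rule strict_mono_onI)
    fix i j assume ij: "i \<in> {1..n}" "j \<in> {1..n}" "i < j"
    then have "d j = h * d 1 + (j - 1) * \<delta>" "(j - 1) * \<delta> > 0" using d[of j] \<delta> by auto
    moreover have "d i \<le> h * d 1" if "i = 1" using h that by simp
    moreover have "(i - 1) * \<delta> < (j - 1) * \<delta>" using ij \<delta> by auto
    moreover have "d i = h * d 1 + (i - 1) * \<delta>" if "i \<noteq> 1" using d[of i] ij that by simp
    ultimately show "d i < d j" by (cases "i = 1") linarith+
  qed
  then have inj: "inj_on d {1..n}" by (rule strict_mono_on_imp_inj_on)
  \<comment> \<open>Every \<open>d i\<close> is a combination of \<open>d 1\<close> and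
    \<open>\<delta>\<close>, so a common divisor of these two divides the gcd of all
    generators.\<close>
  have "coprime (d 1) \<delta>"
  proof (rule coprimeI)
    fix c assume c: "c dvd d 1" "c dvd \<delta>"
    have "c dvd d i" if "i \<in> {1..n}" for i
      using c d[of i] that by (cases "i = 1") auto
    then have "c dvd Gcd (d ` {1..n})" by (auto intro: Gcd_greatest)
    then show "is_unit c" using gcd by simp
  qed
  then have "gas_semigroup n d h \<delta>"
    using assms(1) h \<delta> d1 d minimally_generates_weight_eq_generator[OF pos inj min]
    by unfold_locales auto
  then show ?thesis by (rule that)
qed

section \<open>Congruence of monomials modulo an ideal\<close>

lemma ideal_sum_mem:
  assumes "ideal J (mpoly_ring n)" "\<And>x. x \<in> A \<Longrightarrow> f x \<in> J"
  shows "sum f A \<in> J"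
  using assms(2)
  by (induction A rule: infinite_finite_induct) (use assms(1) in \<open>auto simp: ideal_mpoly_ring_iff\<close>)

text \<open>Toric ideals are spanned by pure binomials. With one representative per weight,
  \<open>p\<close> is a combination of the differences \<open>u - rep u\<close>, because the
  coefficients of \<open>p\<close> over each representative cancel.\<close>

lemma toric_ideal_subset_ideal:
  fixes J :: "'k::field mpoly set"
  assumes J: "ideal J (mpoly_ring n)"
    and bin: "\<And>u v. Poly_Mapping.keys u \<subseteq> {1..n} \<Longrightarrow> Poly_Mapping.keys v \<subseteq> {1..n} \<Longrightarrow>
      weight d u = weight d v \<Longrightarrow> pure_binomial u v \<in> J"
  shows "toric_ideal n d \<subseteq> J"
proof
  fix p :: "'k mpoly" assume "p \<in> toric_ideal n d"
  then have p: "p \<in> mpolys n" "toric_hom d p = 0" by (auto simp: toric_ideal_iff)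
  \<comment> \<open>The choice depends on \<open>u\<close> through its weight alone, so monomials of
    equal weight get the same representative.\<close>
  define rep where
    "rep u = (SOME v. Poly_Mapping.keys v \<subseteq> {1..n} \<and> weight d v = weight d u)" for u :: "nat \<Rightarrow>\<^sub>0 nat"
  let ?c = "Poly_Mapping.lookup p" and ?K = "Poly_Mapping.keys p"
  have K: "Poly_Mapping.keys u \<subseteq> {1..n}" if "u \<in> ?K" for u
    using p(1) that by (auto simp: mpolys_def)
  have rep: "Poly_Mapping.keys (rep u) \<subseteq> {1..n} \<and> weight d (rep u) = weight d u" if "u \<in> ?K" for u
    unfolding rep_def by (rule someI[of _ u]) (use K[OF that] in simp)
  have rep_eq: "rep u = rep v \<longleftrightarrow> weight d u = weight d v" if "u \<in> ?K" "v \<in> ?K" for u v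
    using rep[OF that(1)] rep[OF that(2)] by (metis rep_def)
  have "(\<Sum>u\<in>?K. Poly_Mapping.single (rep u) (?c u)) = 0"
  proof (rule poly_mapping_eqI)
    fix x
    have "(\<Sum>u\<in>?K. Poly_Mapping.lookup (Poly_Mapping.single (rep u) (?c u)) x) =
        (\<Sum>u | u \<in> ?K \<and> rep u = x. ?c u)"
      by (simp add: lookup_single when_def sum.If_cases Int_def)
    also have "\<dots> = 0"
    proof (cases "x \<in> rep ` ?K")
      case True
      then obtain v where "v \<in> ?K" "x = rep v" by blast
      then have "{u. u \<in> ?K \<and> rep u = x} = {u. u \<in> ?K \<and> weight d u = weight d v}"
        using rep_eq by blast
      then show ?thesis using coeff_toric_hom[of d p "weight d v"] p(2) by simp
    next
      case False
      then have "{u. u \<in> ?K \<and> rep u = x} = {}" by blast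
      then show ?thesis by (simp only: sum.empty)
    qed
    finally show "Poly_Mapping.lookup (\<Sum>u\<in>?K. Poly_Mapping.single (rep u) (?c u)) x =
        Poly_Mapping.lookup 0 x"
      by (simp add: lookup_sum)
  qed
  moreover have "(\<Sum>u\<in>?K. Poly_Mapping.single 0 (?c u) * pure_binomial u (rep u)) =
      (\<Sum>u\<in>?K. Poly_Mapping.single u (?c u)) - (\<Sum>u\<in>?K. Poly_Mapping.single (rep u) (?c u))"
    by (simp add: pure_binomial_def right_diff_distrib mult_single sum_subtractf)
  ultimately have "p = (\<Sum>u\<in>?K. Poly_Mapping.single 0 (?c u) * pure_binomial u (rep u))"
    using poly_mapping_sum_single[of p] by simp
  moreover have "\<dots> \<in> J"
  proof (rule ideal_sum_mem[OF J])
    fix u assume "u \<in> ?K"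
    then have "pure_binomial u (rep u) \<in> J" using rep K by (intro bin) auto
    then show "Poly_Mapping.single 0 (?c u) * pure_binomial u (rep u) \<in> J"
      using J unfolding ideal_mpoly_ring_iff by auto
  qed
  ultimately show "p \<in> J" by simp
qed

lemma binomial_ideal_refl: "ideal J (mpoly_ring n) \<Longrightarrow> pure_binomial u u \<in> (J :: 'k::field mpoly set)"
  by (simp add: ideal_mpoly_ring_iff pure_binomial_def)

lemma binomial_ideal_trans:
  assumes "ideal J (mpoly_ring n)" "pure_binomial u v \<in> (J :: 'k::field mpoly set)" "pure_binomial v w \<in> J"
  shows "pure_binomial u w \<in> J"
proof -
  have "pure_binomial u w = (pure_binomial u v + pure_binomial v w :: 'k mpoly)" by (simp add: pure_binomial_def)
  then show ?thesis using assms by (auto simp: ideal_mpoly_ring_iff)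
qed

lemma binomial_ideal_sym:
  assumes "ideal J (mpoly_ring n)" "pure_binomial u v \<in> (J :: 'k::field mpoly set)"
  shows "pure_binomial v u \<in> J"
proof -
  have "pure_binomial v u = (- 1 * pure_binomial u v :: 'k mpoly)" by (simp add: pure_binomial_def)
  then show ?thesis using assms mpolys_uminus[OF mpolys_1, where 'a = 'k] unfolding ideal_mpoly_ring_iff by metis
qed

lemma binomial_ideal_add:
  assumes "ideal J (mpoly_ring n)" "pure_binomial u v \<in> (J :: 'k::field mpoly set)"
    "Poly_Mapping.keys w \<subseteq> {1..n}"
  shows "pure_binomial (w + u) (w + v) \<in> J"
proof -
  have "pure_binomial (w + u) (w + v) = (Poly_Mapping.single w 1 * pure_binomial u v :: 'k mpoly)"
    by (simp add: pure_binomial_def right_diff_distrib mult_single)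
  then show ?thesis using assms mpolys_single[of w n "1 :: 'k"] unfolding ideal_mpoly_ring_iff by metis
qed

section \<open>Generalized arithmetic sequences\<close>

context gas_semigroup
begin

lemma pos: "\<forall>i\<in>{1..n}. d i > 0"
proof
  fix i assume "i \<in> {1..n}"
  then show "d i > 0" using d1 h d[of i] by (cases "i = 1") auto
qed

lemma gas_isolated_power:
  assumes "i \<in> {1..n}"
  obtains c v where "c > 0" "isolated n d (Poly_Mapping.single i c)"
    "Poly_Mapping.keys v \<subseteq> {1..n} - {i}" "weight d v = d i * c"
    "\<And>c' v'. c' > 0 \<Longrightarrow> Poly_Mapping.keys v' \<subseteq> {1..n} - {i} \<Longrightarrow> weight d v' = d i * c' \<Longrightarrow> c \<le> c'"
proof -
  have "(if i = 1 then 2 else 1) \<in> {1..n}" "i \<noteq> (if i = 1 then 2 else 1)" using n by auto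
  then show ?thesis by (rule isolated_least_power[OF pos assms _ _ that])
qed

text \<open>Cancelling a shared variable leaves a monomial with the weight of one generator, and
  \<open>unique\<close> identifies it with the other factor.\<close>

lemma isolated_quadric:
  assumes "i \<in> {1..n}" "j \<in> {1..n}"
  shows "isolated n d (Poly_Mapping.single i 1 + Poly_Mapping.single j 1)"
  unfolding isolated_def
proof (intro allI impI, elim conjE)
  have *: "v = Poly_Mapping.single i 1 + Poly_Mapping.single j 1"
    if "Poly_Mapping.keys v \<subseteq> {1..n}" "weight d v = d i + d j" "i \<in> Poly_Mapping.keys v"
      "i \<in> {1..n}" "j \<in> {1..n}" for v i j
  proof -
    let ?w = "v - Poly_Mapping.single i 1"
    have v: "v = Poly_Mapping.single i 1 + ?w"
      using that(3) by (intro poly_mapping_eqI)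
        (auto simp: lookup_add lookup_minus lookup_single when_def in_keys_iff)
    have "Poly_Mapping.keys ?w \<subseteq> Poly_Mapping.keys v"
      by (auto simp: in_keys_iff lookup_minus)
    moreover have "d i + weight d ?w = d i + d j"
      using arg_cong[OF v, of "weight d"] that(2) by (simp only: weight_add weight_single mult_1_right)
    ultimately have "?w = Poly_Mapping.single j 1"
      using unique[of j ?w] that by simp
    then show ?thesis using v by simp
  qed
  fix v
  assume "Poly_Mapping.keys v \<subseteq> {1..n}"
    "weight d v = weight d (Poly_Mapping.single i 1 + Poly_Mapping.single j 1)"
    "Poly_Mapping.keys (Poly_Mapping.single i (1 :: nat) + Poly_Mapping.single j 1) \<inter> Poly_Mapping.keys v \<noteq> {}"
  then show "v = Poly_Mapping.single i 1 + Poly_Mapping.single j 1"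
    using *[of v i j] *[of v j i] assms by (auto simp: add.commute)
qed

section \<open>Lower bounds on the number of generators\<close>

text \<open>Used for \<open>n = 3\<close> and even \<open>d 1\<close>, where two generators suffice.
  The first relation is \<open>x_2^2 = x_1^h x_3\<close>, from
  \<open>2 * d 2 = h * d 1 + d 3\<close>.\<close>

lemma two_le_card_generators:
  fixes G :: "'k::field mpoly set"
  assumes G: "G \<subseteq> carrier (mpoly_ring n)" "finite G" "genideal (mpoly_ring n) G = toric_ideal n d"
  shows "2 \<le> card G"
proof -
  have gen: "1 \<in> {1..n}" using n by simp
  obtain c v where c: "c > 0" "isolated n d (Poly_Mapping.single 1 c)"
    and v: "Poly_Mapping.keys v \<subseteq> {1..n} - {1}" "weight d v = d 1 * c"
    by (metis gas_isolated_power[OF gen])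
  \<comment> \<open>\<open>v\<close> is not known explicitly, so the relation of
    \<open>x_1^c\<close> comes last, where \<open>tri\<close> does not constrain its second
    monomial.\<close>
  define U :: "nat \<Rightarrow> nat \<Rightarrow>\<^sub>0 nat" where "U j = (if j = 0 then Poly_Mapping.single 2 1 + Poly_Mapping.single 2 1
    else Poly_Mapping.single 1 c)" for j :: nat
  define V :: "nat \<Rightarrow> nat \<Rightarrow>\<^sub>0 nat" where "V j = (if j = 0 then Poly_Mapping.single 1 h + Poly_Mapping.single 3 1 else v)"
    for j :: nat
  have v1: "Poly_Mapping.lookup v 1 = 0" using v(1) by (auto simp: in_keys_iff)
  show ?thesis
  proof (rule card_generators_ge[OF G, of _ U V])
    fix j :: nat assume j: "j < 2"
    show "isolated n d (U j)" using isolated_quadric[of 2 2] c(2) n by (simp add: U_def)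
    show "Poly_Mapping.keys (U j) \<subseteq> {1..n} \<and> Poly_Mapping.keys (V j) \<subseteq> {1..n}"
      using n v(1) by (auto simp: U_def V_def split: if_splits)
    show "weight d (U j) = weight d (V j)"
      using n v(2) d[of 2] d[of 3] by (auto simp: U_def V_def)
    show "U j \<noteq> V j"
      using h c(1) v1 by (intro lookup_neqI[of _ 1]) (simp add: U_def V_def lookup_add lookup_single)
  next
    fix i j :: nat assume "i < j" "j < 2"
    then have ij: "i = 0" "j = 1" by auto
    have "U 1 \<noteq> U 0" using c(1) by (intro lookup_neqI[of _ 1]) (simp add: U_def lookup_add lookup_single)
    moreover have "U 1 \<noteq> V 0"
      by (intro lookup_neqI[of _ 3]) (simp add: U_def V_def lookup_add lookup_single)
    ultimately show "U j \<noteq> U i \<and> U j \<noteq> V i" using ij by simp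
  qed
qed

text \<open>The first \<open>n - 2\<close> relations are \<open>x_2 x_i = x_1^h x_(i+1)\<close> for
  \<open>i\<close> from 2 to \<open>n - 1\<close>; then come \<open>x_3 x_(n-1) = x_2 x_n\<close>,
  which would be trivial for \<open>n = 3\<close>, and the least power of
  \<open>x_1\<close>.\<close>

lemma n_le_card_generators:
  fixes G :: "'k::field mpoly set"
  assumes "n \<ge> 4"
    and G: "G \<subseteq> carrier (mpoly_ring n)" "finite G" "genideal (mpoly_ring n) G = toric_ideal n d"
  shows "n \<le> card G"
proof -
  have gen: "1 \<in> {1..n}" using n by simp
  obtain c v where c: "c > 0" "isolated n d (Poly_Mapping.single 1 c)"
    and v: "Poly_Mapping.keys v \<subseteq> {1..n} - {1}" "weight d v = d 1 * c"
    by (metis gas_isolated_power[OF gen])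
  define U :: "nat \<Rightarrow> nat \<Rightarrow>\<^sub>0 nat" where "U j =
    (if j < n - 2 then Poly_Mapping.single 2 1 + Poly_Mapping.single (j + 2) 1
     else if j = n - 2 then Poly_Mapping.single 3 1 + Poly_Mapping.single (n - 1) 1
     else Poly_Mapping.single 1 c)" for j
  define V :: "nat \<Rightarrow> nat \<Rightarrow>\<^sub>0 nat" where "V j =
    (if j < n - 2 then Poly_Mapping.single 1 h + Poly_Mapping.single (j + 3) 1
     else if j = n - 2 then Poly_Mapping.single 2 1 + Poly_Mapping.single n 1
     else v)" for j
  have v1: "Poly_Mapping.lookup v 1 = 0" using v(1) by (auto simp: in_keys_iff)
  show ?thesis
  proof (rule card_generators_ge[OF G, of _ U V])
    fix j assume j: "j < n"
    consider "j < n - 2" | "j = n - 2" | "j = n - 1" using j by linarith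
    note cases = this
    show "isolated n d (U j)"
      using cases isolated_quadric c(2) assms(1) by cases (auto simp: U_def)
    show "Poly_Mapping.keys (U j) \<subseteq> {1..n} \<and> Poly_Mapping.keys (V j) \<subseteq> {1..n}"
      using cases v(1) assms(1) by cases (auto simp: U_def V_def)
    show "weight d (U j) = weight d (V j)"
      using cases
    proof cases
      case 1
      then show ?thesis
        using d[of 2] d[of "j + 2"] d[of "j + 3"] by (simp add: U_def V_def)
    next
      case 2
      \<comment> \<open>Writing \<open>n\<close> as \<open>l + 4\<close> removes the truncated
        subtractions.\<close>
      obtain l where "n = l + 4" using assms(1) by (metis add.commute le_Suc_ex)
      then show ?thesis
        using d[of 2] d[of 3] d[of "l + 3"] d[of "l + 4"] 2
        by (simp add: U_def V_def algebra_simps)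
    next
      case 3
      then have "\<not> j < n - 2" "j \<noteq> n - 2" using assms(1) by auto
      then show ?thesis using v(2) by (simp add: U_def V_def)
    qed
    show "U j \<noteq> V j"
      using cases
    proof cases
      case 1
      then show ?thesis
        using h by (intro lookup_neqI[of _ 1]) (simp add: U_def V_def lookup_add lookup_single)
    next
      case 2
      then show ?thesis
        using assms(1) by (intro lookup_neqI[of _ n]) (simp add: U_def V_def lookup_add lookup_single when_def)
    next
      case 3
      then have "\<not> j < n - 2" "j \<noteq> n - 2" using assms(1) by auto
      then show ?thesis using c(1) v1 by (intro lookup_neqI[of _ 1]) (simp add: U_def V_def)
    qed
  next
    fix i j assume ij: "i < j" "j < n"
    consider "j < n - 2" | "j = n - 2" | "j = n - 1" using ij by linarith
    then show "U j \<noteq> U i \<and> U j \<noteq> V i"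
    proof cases
      case 1
      have "U j \<noteq> U i" using ij 1
        by (intro lookup_neqI[of _ "j + 2"]) (simp add: U_def lookup_add lookup_single when_def)
      moreover have "U j \<noteq> V i" using ij 1 h
        by (intro lookup_neqI[of _ 1]) (simp add: U_def V_def lookup_add lookup_single when_def)
      ultimately show ?thesis ..
    next
      case 2
      have "U j \<noteq> U i" using ij 2 assms(1)
        by (intro lookup_neqI[of _ 2]) (simp add: U_def lookup_add lookup_single when_def)
      moreover have "U j \<noteq> V i" using ij 2 h assms(1)
        by (intro lookup_neqI[of _ 1]) (auto simp: U_def V_def lookup_add lookup_single when_def)
      ultimately show ?thesis ..
    next
      case 3
      have "U j \<noteq> U i" using ij 3 c(1) assms(1)
        by (intro lookup_neqI[of _ 1]) (auto simp: U_def lookup_add lookup_single when_def)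
      \<comment> \<open>The witness is a variable of \<open>V i\<close> other than
        \<open>x_1\<close>, so that no comparison of \<open>c\<close> with \<open>h\<close>
        arises.\<close>
      moreover have "U j \<noteq> V i" using ij 3 assms(1)
        by (intro lookup_neqI[of _ "if i < n - 2 then i + 3 else n"])
          (auto simp: U_def V_def lookup_add lookup_single when_def)
      ultimately show ?thesis ..
    qed
  qed
qed

text \<open>The relations of \<open>x_2^2\<close>, \<open>x_1^c\<close> and \<open>x_3^c3\<close>
  are triangular as soon as \<open>v\<close> differs from \<open>x_3^c3\<close>. Equality would make
  \<open>d 3\<close> divide \<open>d 1 * c\<close>, hence \<open>c\<close> for odd
  \<open>d 1\<close>, whereas \<open>c\<close> is less than \<open>d 3\<close>.\<close>

lemma three_le_card_generators:
  fixes G :: "'k::field mpoly set"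
  assumes "n = 3" "odd (d 1)"
    and G: "G \<subseteq> carrier (mpoly_ring n)" "finite G" "genideal (mpoly_ring n) G = toric_ideal n d"
  shows "3 \<le> card G"
proof -
  have d2: "d 2 = h * d 1 + \<delta>" and d3: "d 3 = h * d 1 + 2 * \<delta>"
    using d[of 2] d[of 3] n by auto
  have gens: "1 \<in> {1..n}" "3 \<in> {1..n}" using n by auto
  obtain c v where c: "c > 0" "isolated n d (Poly_Mapping.single 1 c)"
    and v: "Poly_Mapping.keys v \<subseteq> {1..n} - {1}" "weight d v = d 1 * c"
    and least: "\<And>c' v'. c' > 0 \<Longrightarrow> Poly_Mapping.keys v' \<subseteq> {1..n} - {1} \<Longrightarrow>
      weight d v' = d 1 * c' \<Longrightarrow> c \<le> c'"
    using gas_isolated_power[OF gens(1)] by blast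
  obtain c3 v3 where c3: "c3 > 0" "isolated n d (Poly_Mapping.single 3 c3)"
    and v3: "Poly_Mapping.keys v3 \<subseteq> {1..n} - {3}" "weight d v3 = d 3 * c3"
    by (metis gas_isolated_power[OF gens(2)])
  obtain m where m: "d 1 = 2 * m + 1" using assms(2) by (auto elim: oddE)
  have "c < d 3"
  proof -
    \<comment> \<open>With \<open>d 1 = 2 * m + 1\<close> the monomial \<open>x_2 x_3^m\<close> has
      weight divisible by \<open>d 1\<close>, which bounds the least power of
      \<open>x_1\<close>.\<close>
    have "c \<le> h * (m + 1) + \<delta>"
    proof (rule least)
      show "Poly_Mapping.keys (Poly_Mapping.single 2 1 + Poly_Mapping.single 3 m) \<subseteq> {1..n} - {1}"
        using n by auto
      show "weight d (Poly_Mapping.single 2 1 + Poly_Mapping.single 3 m) = d 1 * (h * (m + 1) + \<delta>)"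
        by (simp add: d2 d3 m algebra_simps del: One_nat_def)
    qed (use \<delta> in simp)
    also have "\<dots> < h * d 1 + 2 * \<delta>" using \<delta> by (simp add: m algebra_simps del: One_nat_def)
    finally show ?thesis using d3 by simp
  qed
  have "coprime (d 1) (d 3)"
  proof -
    \<comment> \<open>Modulo \<open>d 1\<close>, \<open>d 3\<close> is \<open>2 * \<delta>\<close>,
      which is a unit because \<open>d 1\<close> is odd and coprime to
      \<open>\<delta>\<close>.\<close>
    have "coprime (d 1) (2 * \<delta>)" using coprime assms(2) by simp
    then show ?thesis unfolding d3 by (metis coprime_iff_gcd_eq_1 gcd_add_mult add.commute mult.commute)
  qed
  \<comment> \<open>For even \<open>d 1\<close> this fails: the least relations of the first and third variable coincide.\<close>
  have v_ne: "v \<noteq> Poly_Mapping.single 3 c3"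
  proof
    assume "v = Poly_Mapping.single 3 c3"
    then have "d 3 dvd d 1 * c" using v(2) by (metis dvd_triv_left weight_single)
    then have "d 3 dvd c"
      using \<open>coprime (d 1) (d 3)\<close> by (simp add: coprime_dvd_mult_right_iff coprime_commute)
    then show False using \<open>c < d 3\<close> c(1) by (auto dest: dvd_imp_le)
  qed
  define U :: "nat \<Rightarrow> nat \<Rightarrow>\<^sub>0 nat" where "U j = (if j = 0 then Poly_Mapping.single 2 1 + Poly_Mapping.single 2 1
    else if j = 1 then Poly_Mapping.single 1 c else Poly_Mapping.single 3 c3)" for j :: nat
  define V :: "nat \<Rightarrow> nat \<Rightarrow>\<^sub>0 nat" where "V j = (if j = 0 then Poly_Mapping.single 1 h + Poly_Mapping.single 3 1
    else if j = 1 then v else v3)" for j :: nat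
  have v1: "Poly_Mapping.lookup v 1 = 0" "Poly_Mapping.lookup v3 3 = 0"
    using v(1) v3(1) by (auto simp: in_keys_iff)
  show ?thesis
  proof (rule card_generators_ge[OF G, of _ U V])
    fix j :: nat assume "j < 3"
    then consider "j = 0" | "j = 1" | "j = 2" by linarith
    note cases = this
    show "isolated n d (U j)" using cases isolated_quadric[of 2 2] c(2) c3(2) n by cases (simp_all add: U_def)
    show "Poly_Mapping.keys (U j) \<subseteq> {1..n} \<and> Poly_Mapping.keys (V j) \<subseteq> {1..n}"
      using n v(1) v3(1) by (auto simp: U_def V_def split: if_splits)
    show "weight d (U j) = weight d (V j)"
      using v(2) v3(2) by (auto simp: U_def V_def d2 d3)
    show "U j \<noteq> V j"
      using h c(1) c3(1) v1
      by (intro lookup_neqI[of _ "if j = 2 then 3 else 1"]) (use cases in \<open>auto simp: U_def V_def lookup_add lookup_single\<close>)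
  next
    fix i j :: nat assume "i < j" "j < 3"
    then consider "i = 0" "j = 1" | "i = 0" "j = 2" | "i = 1" "j = 2" by linarith
    then show "U j \<noteq> U i \<and> U j \<noteq> V i"
    proof cases
      case 1
      have "U 1 \<noteq> U 0" using c(1) by (intro lookup_neqI[of _ 1]) (simp add: U_def lookup_add lookup_single)
      moreover have "U 1 \<noteq> V 0"
        by (intro lookup_neqI[of _ 3]) (simp add: U_def V_def lookup_add lookup_single)
      ultimately show ?thesis using 1 by simp
    next
      case 2
      have "U 2 \<noteq> U 0" using c3(1) by (intro lookup_neqI[of _ 3]) (simp add: U_def lookup_add lookup_single)
      moreover have "U 2 \<noteq> V 0"
        using h by (intro lookup_neqI[of _ 1]) (simp add: U_def V_def lookup_add lookup_single)
      ultimately show ?thesis using 2 by simp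
    next
      case 3
      have "U 2 \<noteq> U 1" using c3(1) by (intro lookup_neqI[of _ 3]) (simp add: U_def lookup_single)
      then show ?thesis using 3 v_ne by (auto simp: V_def U_def)
    qed
  qed
qed

section \<open>Two generators in the even case\<close>

text \<open>\<open>g\<close> is a relation because \<open>m * d 3 = d 1 * (m * h + \<delta>)\<close>
  for \<open>d 1 = 2 * m\<close>. Both binomials act as rewriting rules, and distinct normal forms
  have distinct weights, so monomials of equal weight are congruent modulo the ideal.\<close>

lemma toric_ideal_eq_genideal:
  assumes "n = 3" and m: "d 1 = 2 * m"
  defines "f \<equiv> pure_binomial (Poly_Mapping.single 2 2) (Poly_Mapping.single 1 h + Poly_Mapping.single 3 1) :: 'k::field mpoly"
    and "g \<equiv> pure_binomial (Poly_Mapping.single 3 m) (Poly_Mapping.single 1 (m * h + \<delta>)) :: 'k mpoly"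
  shows "{f, g} \<subseteq> toric_ideal n d" "genideal (mpoly_ring n) {f, g} = toric_ideal n d"
proof -
  interpret R: cring "mpoly_ring n :: 'k mpoly ring" by (rule mpoly_ring_cring)
  have d2: "d 2 = h * d 1 + \<delta>" and d3: "d 3 = h * d 1 + 2 * \<delta>"
    using d[of 2] d[of 3] n by auto
  have "f \<in> toric_ideal n d" "g \<in> toric_ideal n d"
    unfolding f_def g_def using n
    by (auto intro!: binomial_in_toric_ideal simp: d2 d3 m algebra_simps simp del: One_nat_def
        split: if_splits)
  then show fg: "{f, g} \<subseteq> toric_ideal n d" by simp
  then have carrier: "{f, g} \<subseteq> carrier (mpoly_ring n)" by (auto simp: toric_ideal_def)
  define J where "J = genideal (mpoly_ring n) {f, g}"
  have J: "ideal J (mpoly_ring n)" unfolding J_def by (rule R.genideal_ideal[OF carrier])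
  have J_subset: "J \<subseteq> toric_ideal n d"
    unfolding J_def by (rule R.genideal_minimal[OF ideal_toric_ideal fg])
  have fgJ: "f \<in> J" "g \<in> J" using R.genideal_self[OF carrier] by (auto simp: J_def)
  define M :: "nat \<Rightarrow> nat \<Rightarrow> nat \<Rightarrow> (nat \<Rightarrow>\<^sub>0 nat)" where "M i j k = Poly_Mapping.single 1 i + Poly_Mapping.single 2 j + Poly_Mapping.single 3 k"
    for i j k :: nat
  have keys_M: "Poly_Mapping.keys (M i j k) \<subseteq> {1..n}" for i j k
    using n by (auto simp: M_def split: if_splits)
  have weight_M: "weight d (M i j k) = d 1 * (i + h * (j + k)) + \<delta> * (j + 2 * k)" for i j k
    by (simp add: M_def d2 d3 algebra_simps)
  have m0: "m > 0" using d1 m by simp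
  have red2: "pure_binomial (M i j k) (M (i + h) (j - 2) (k + 1)) \<in> J" if "j \<ge> 2" for i j k
  proof -
    have "M i j k = M i (j - 2) k + Poly_Mapping.single 2 2"
      "M (i + h) (j - 2) (k + 1) = M i (j - 2) k + (Poly_Mapping.single 1 h + Poly_Mapping.single 3 1)"
      using that by (auto simp: M_def lookup_add lookup_single when_def intro!: poly_mapping_eqI)
    then show ?thesis using binomial_ideal_add[OF J fgJ(1)[unfolded f_def] keys_M[of i "j - 2" k]] by simp
  qed
  have red3: "pure_binomial (M i j k) (M (i + (m * h + \<delta>)) j (k - m)) \<in> J" if "k \<ge> m" for i j k
  proof -
    have "M i j k = M i j (k - m) + Poly_Mapping.single 3 m"
      "M (i + (m * h + \<delta>)) j (k - m) = M i j (k - m) + Poly_Mapping.single 1 (m * h + \<delta>)"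
      using that by (auto simp: M_def lookup_add lookup_single when_def intro!: poly_mapping_eqI)
    then show ?thesis using binomial_ideal_add[OF J fgJ(2)[unfolded g_def] keys_M[of i j "k - m"]] by simp
  qed
  have nf3: "\<exists>i' k'. k' < m \<and> pure_binomial (M i j k) (M i' j k') \<in> J" for i j k
  proof (induction k arbitrary: i rule: less_induct)
    case (less k)
    show ?case
    proof (cases "k < m")
      case True
      then show ?thesis using binomial_ideal_refl[OF J] by blast
    next
      case False
      then have "k - m < k" "m \<le> k" using m0 by auto
      moreover obtain i' k' where "k' < m"
        "pure_binomial (M (i + (m * h + \<delta>)) j (k - m)) (M i' j k') \<in> J"
        using less[OF \<open>k - m < k\<close>] by blast
      ultimately show ?thesis using binomial_ideal_trans[OF J red3] by blast
    qed
  qed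
  \<comment> \<open>Rewriting by \<open>f\<close> raises the exponent of \<open>x_3\<close>, so
    \<open>x_2\<close> is reduced first; \<open>nf3\<close> then leaves the exponent of
    \<open>x_2\<close> alone.\<close>
  have nf2: "\<exists>i' j' k'. j' < 2 \<and> k' < m \<and> pure_binomial (M i j k) (M i' j' k') \<in> J" for i j k
  proof (induction j arbitrary: i k rule: less_induct)
    case (less j)
    show ?case
    proof (cases "j < 2")
      case True
      then show ?thesis using nf3 by blast
    next
      case False
      then have "j - 2 < j" "j \<ge> 2" by auto
      then obtain i' j' k' where "j' < 2" "k' < m"
        "pure_binomial (M (i + h) (j - 2) (k + 1)) (M i' j' k') \<in> J"
        using less[of "j - 2" "i + h" "k + 1"] by blast
      then show ?thesis using binomial_ideal_trans[OF J red2[OF \<open>j \<ge> 2\<close>]] by blast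
    qed
  qed
  have nf: "\<exists>i j k. j < 2 \<and> k < m \<and> pure_binomial u (M i j k) \<in> J" if "Poly_Mapping.keys u \<subseteq> {1..n}" for u
  proof -
    have "u = M (Poly_Mapping.lookup u 1) (Poly_Mapping.lookup u 2) (Poly_Mapping.lookup u 3)"
    proof (rule poly_mapping_eqI)
      fix i
      have "i = 1 \<or> i = 2 \<or> i = 3" if "Poly_Mapping.lookup u i \<noteq> 0"
      proof -
        have "i \<in> Poly_Mapping.keys u" using that by (simp add: in_keys_iff)
        then have "1 \<le> i" "i \<le> 3" using \<open>Poly_Mapping.keys u \<subseteq> {1..n}\<close> \<open>n = 3\<close> by auto
        then show ?thesis by linarith
      qed
      then show "Poly_Mapping.lookup u i =
          Poly_Mapping.lookup (M (Poly_Mapping.lookup u 1) (Poly_Mapping.lookup u 2) (Poly_Mapping.lookup u 3)) i"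
        by (auto simp: M_def lookup_add lookup_single when_def)
    qed
    then obtain a b c where "u = M a b c" by blast
    then show ?thesis using nf2[where i = a and j = b and k = c] by simp
  qed
  have nf_unique: "M i j k = M i' j' k'"
    if "weight d (M i j k) = weight d (M i' j' k')" "j < 2" "k < m" "j' < 2" "k' < m" for i j k i' j' k'
  proof -
    have "[\<delta> * (j + 2 * k) = \<delta> * (j' + 2 * k')] (mod d 1)"
      using arg_cong[OF that(1), of "\<lambda>x. x mod d 1"] by (simp add: weight_M cong_def)
    then have "[j + 2 * k = j' + 2 * k'] (mod d 1)"
      using coprime by (simp add: cong_mult_lcancel_nat coprime_commute)
    \<comment> \<open>Both sides lie below \<open>2 * m = d 1\<close>, so congruence is equality; as
      \<open>j\<close> and \<open>j'\<close> are less than 2, the sum then determines both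
      exponents.\<close>
    then have eq: "j + 2 * k = j' + 2 * k'"
      using that m by (auto simp: cong_def)
    then have "k = k'" using that by linarith
    moreover from this have "j = j'" using eq by simp
    ultimately show ?thesis using that(1) d1 by (simp add: weight_M)
  qed
  have "toric_ideal n d \<subseteq> J"
  proof (rule toric_ideal_subset_ideal[OF J])
    fix u v
    assume u: "Poly_Mapping.keys u \<subseteq> {1..n}" and v: "Poly_Mapping.keys v \<subseteq> {1..n}"
      and wt: "weight d u = weight d v"
    \<comment> \<open>Reduction preserves weights because \<open>J\<close> lies in the toric
      ideal.\<close>
    have wt_eq: "weight d x = weight d y"
      if "pure_binomial x y \<in> J" for x y :: "nat \<Rightarrow>\<^sub>0 nat"
    proof -
      have "pure_binomial x y \<in> (toric_ideal n d :: 'k mpoly set)"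
        using that J_subset by blast
      then have "monom 1 (weight d x) = (monom 1 (weight d y) :: 'k poly)"
        using toric_hom_add[of d "pure_binomial x y" "Poly_Mapping.single y (1 :: 'k)"]
        by (simp add: toric_ideal_iff pure_binomial_def toric_hom_single weight_def)
      then show ?thesis by (metis degree_monom_eq one_neq_zero)
    qed
    obtain i j k where a: "j < 2" "k < m" "pure_binomial u (M i j k) \<in> J" using nf[OF u] by blast
    obtain i' j' k' where b: "j' < 2" "k' < m" "pure_binomial v (M i' j' k') \<in> J" using nf[OF v] by blast
    have "weight d (M i j k) = weight d (M i' j' k')"
      using wt_eq[OF a(3)] wt_eq[OF b(3)] wt by simp
    then have "M i j k = M i' j' k'" using a(1,2) b(1,2) by (rule nf_unique)
    then show "pure_binomial u v \<in> J"
      using binomial_ideal_trans[OF J a(3)] binomial_ideal_sym[OF J b(3)] by simp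
  qed
  then show "genideal (mpoly_ring n) {f, g} = toric_ideal n d"
    using J_subset unfolding J_def by blast
qed

end

theorem theorem3p5:
  fixes n :: nat and d :: "nat \<Rightarrow> nat"
  assumes "n \<ge> 3"
    and "\<forall>i\<in>{1..n}. d i > 0"
    and "generalized_arithmetic_sequence n d"
    and "Gcd (d ` {1..n}) = 1"
    and "minimally_generates (d ` {1..n}) (generated_semigroup (d ` {1..n}))"
  shows "toric_complete_intersection TYPE('k::field) n d \<longleftrightarrow> n = 3 \<and> even (d 1)"
proof -
  obtain h \<delta> where "gas_semigroup n d h \<delta>"
    using gas_semigroupI[OF assms] .
  then interpret gas_semigroup n d h \<delta> .
  show ?thesis
  proof
    assume "toric_complete_intersection TYPE('k) n d"
    then obtain G :: "'k mpoly set" where G: "G \<subseteq> carrier (mpoly_ring n)" "finite G"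
      "genideal (mpoly_ring n) G = toric_ideal n d" and card: "card G = n - 1"
      unfolding toric_complete_intersection_def minimal_number_of_generators_def by blast
    have "n = 3" using n_le_card_generators[OF _ G] card n by fastforce
    moreover have "even (d 1)" using three_le_card_generators[OF _ _ G] card calculation by fastforce
    ultimately show "n = 3 \<and> even (d 1)" ..
  next
    assume *: "n = 3 \<and> even (d 1)"
    then obtain m where "d 1 = 2 * m" by blast
    from toric_ideal_eq_genideal[OF _ this, where 'k = 'k] * obtain f g :: "'k mpoly"
      where fg: "{f, g} \<subseteq> toric_ideal n d" "genideal (mpoly_ring n) {f, g} = toric_ideal n d"
      by blast
    then have carrier: "{f, g} \<subseteq> carrier (mpoly_ring n)" by (auto simp: toric_ideal_def)
    \<comment> \<open>No generating set has fewer than two elements, so \<open>f\<close> and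
      \<open>g\<close> differ.\<close>
    have "card {f, g} = 2"
      using two_le_card_generators[OF carrier _ fg(2)] card_insert_le_m1[of 2 "{g}" f] by simp
    moreover have "2 \<le> card G" if "G \<subseteq> carrier (mpoly_ring n)" "finite G"
      "genideal (mpoly_ring n) G = toric_ideal n d" for G :: "'k mpoly set"
      using two_le_card_generators that by blast
    ultimately show "toric_complete_intersection TYPE('k) n d"
      using * carrier fg(2)
      unfolding toric_complete_intersection_def minimal_number_of_generators_def
      by (auto intro!: exI[of _ "{f, g}"])
  qed
qed

end
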